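(* For every $n\geq 0$ and every word $v$ of length $n$ beginning with the letter $a$, $$|\psi(v)|_b\leq|\psi(v^{(n)})|_b=F_{n-1}-1,$$ and equality holds if and only if $v=v^{(n)}$ or $v=E(d(v^{(n)}))$.
   Context: Let $\mathcal{A}=\{a,b\}$. $|w|_b$ is the number of occurrences of $b$ in $w$. $w^{(+)}$ is the shortest palindrome having $w$ as a prefix; $\psi(\varepsilon)=\varepsilon$, $\psi(vx)=(\psi(v)x)^{(+)}$ for $v\in\mathcal{A}^*$, $x\in\mathcal{A}$. $v^{(n)}$ is the prefix of length $n$ of $(ab)^\omega$. $E$ is the automorphism exchanging $a$ and $b$. The operator $d$ on $\mathcal{A}^*$ is defined by $d(\varepsilon)=\varepsilon$, $d(x)=x$ for $x\in\mathcal{A}$, and $d(xyu)=yxu$ for $x,y\in\mathcal{A}$, $u\in\mathcal{A}^*$ (it swaps the first two letters). Fibonacci numbers: $F_{-1}=F_0=1$, $F_{n+1}=F_n+F_{n-1}$. *)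

theory Defs
  imports Main "HOL-Library.Sublist" "HOL-Library.Stream" "HOL-Number_Theory.Fib"
begin

datatype letter = La | Lb

type_synonym word = "letter list"

definition palindrome :: "'a list \<Rightarrow> bool" where
  "palindrome w \<longleftrightarrow> rev w = w"

definition is_pal_closure :: "'a list \<Rightarrow> 'a list \<Rightarrow> bool" where
  "is_pal_closure w p \<longleftrightarrow>
     palindrome p \<and> prefix w p \<and> (\<forall>q. palindrome q \<and> prefix w q \<longrightarrow> length p \<le> length q)"

definition pal_closure :: "'a list \<Rightarrow> 'a list" where
  "pal_closure w = (THE p. is_pal_closure w p)"

lemma is_pal_closure_unique:
  assumes p: "is_pal_closure w p" and q: "is_pal_closure w q"
  shows "p = q"
proof (rule nth_equalityI)
  show len: "length p = length q"
    using p q by (auto simp: is_pal_closure_def intro: le_antisym)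
  have "palindrome (w @ rev w)" "prefix w (w @ rev w)"
    by (simp_all add: palindrome_def)
  with p have "length p \<le> length (w @ rev w)"
    unfolding is_pal_closure_def by blast
  then have L: "length p \<le> 2 * length w" by simp
  have eq: "p ! i = q ! i" if "i < length w" for i
    using p q that by (auto simp: is_pal_closure_def prefix_def nth_append)
  fix i assume i: "i < length p"
  show "p ! i = q ! i"
  proof (cases "i < length w")
    case False
    have "p ! i = p ! (length p - Suc i)"
      using p i by (metis is_pal_closure_def palindrome_def rev_nth)
    also have "\<dots> = q ! (length p - Suc i)" using False L i by (intro eq) linarith
    also have "\<dots> = q ! i"
      using q i len by (metis is_pal_closure_def palindrome_def rev_nth)
    finally show ?thesis .
  qed (rule eq)
qed

lemma is_pal_closure_pal_closure: "is_pal_closure w (pal_closure w)"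
proof -
  have "palindrome (w @ rev w) \<and> prefix w (w @ rev w)" by (simp add: palindrome_def)
  then have "\<exists>p. is_pal_closure w p"
    using ex_has_least_nat[of "\<lambda>p. palindrome p \<and> prefix w p" "w @ rev w" length]
    by (auto simp: is_pal_closure_def)
  then show ?thesis
    unfolding pal_closure_def using is_pal_closure_unique by (metis theI)
qed

definition psi :: "'a list \<Rightarrow> 'a list" where
  "psi v = foldl (\<lambda>w x. pal_closure (w @ [x])) [] v"

lemma psi_Nil: "psi [] = []"
  and psi_snoc: "psi (v @ [x]) = pal_closure (psi v @ [x])"
  by (simp_all add: psi_def)

definition alt :: "nat \<Rightarrow> word" where
  "alt n = stake n (cycle [La, Lb])"

fun exchange_letter :: "letter \<Rightarrow> letter" where
  "exchange_letter La = Lb"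
| "exchange_letter Lb = La"

definition exchange :: "word \<Rightarrow> word" where
  "exchange w = map exchange_letter w"

fun swap_first :: "'a list \<Rightarrow> 'a list" where
  "swap_first [] = []"
| "swap_first [x] = [x]"
| "swap_first (x # y # u) = y # x # u"

text \<open>Fibonacci numbers indexed from \<open>-1\<close>, with \<open>F (-1) = F 0 = 1\<close>; the library's \<open>fib\<close>
  starts with \<open>fib 0 = 0\<close> and \<open>fib 1 = fib 2 = 1\<close>, whence the shift by 2.\<close>

definition F :: "int \<Rightarrow> nat" where
  "F k = fib (nat (k + 2))"

lemma F_minus_one: "F (- 1) = 1"
  and F_zero: "F 0 = 1"
  by (simp_all add: F_def numeral_2_eq_2)

lemma F_rec:
  assumes "k \<ge> 0"
  shows "F (k + 1) = F k + F (k - 1)"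
proof -
  have "nat (k + 1 + 2) = Suc (Suc (nat (k + 1)))" "nat (k + 2) = Suc (nat (k + 1))"
    "nat (k - 1 + 2) = nat (k + 1)"
    using assms by simp_all
  then show ?thesis by (simp only: F_def fib.simps)
qed

end

theory Submission
  imports Defs
begin

text \<open>
  For a fixed letter $z$ put $c(v) = |\psi(v)|_z$. Since the palindromic prefixes of $\psi(v)$ are
  the words $\psi(u)$ with $u$ a prefix of $v$, the longest palindromic suffix of $\psi(v)x$ is
  $x\psi(v_1)x$, where $v_1x$ is the longest prefix of $v$ ending in $x$. This gives
  $c(vx) = 2c(v) - c(v_1)$, so that the increments $g_x(v) = c(vx) - c(v)$ satisfy
  $g_y(vy) = g_y(v)$ and $g_x(vy) = g_x(v) + g_y(v)$ for $x \neq y$. On two letters,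
  $c(v) + 1 = g_a(v) + g_b(v)$, and reading a letter replaces the other letter's increment by the
  sum of both. Starting from $(0,1)$, the first $a$ changes nothing; the sum then grows fastest
  when the smaller increment is always the one replaced, which is the Fibonacci recursion. The
  only tie occurs at $(1,1)$, after $ab$, and accounts for the two extremal words.
\<close>

section \<open>Palindromic closure and the palindromic prefixes of \<open>psi\<close>\<close>

lemma pal_closure_eqI:
  assumes q: "palindrome q"
    and longest: "\<And>z' q'. z @ q = z' @ q' \<Longrightarrow> palindrome q' \<Longrightarrow> length q' \<le> length q"
  shows "pal_closure (z @ q) = z @ q @ rev z"
proof -
  have "length (z @ q @ rev z) \<le> length p" if p: "palindrome p" "prefix (z @ q) p" for p
  proof -
    obtain t where t: "p = (z @ q) @ t" using p(2) by (auto simp: prefix_def)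
    have eq: "(z @ q) @ t = rev t @ rev (z @ q)"
      using p(1) by (simp add: palindrome_def t)
    \<comment> \<open>Since \<open>p\<close> begins with \<open>rev t\<close> and ends with
      \<open>t\<close>, cutting \<open>rev t\<close> off \<open>z @ q\<close> leaves a palindromic
      suffix of \<open>z @ q\<close>. It is at most as long as \<open>q\<close>, so \<open>t\<close>
      is at least as long as \<open>z\<close>.\<close>
    have "length z \<le> length t"
    proof (cases "length t \<le> length (z @ q)")
      case True
      then have "prefix (rev t) (z @ q)"
        using prefix_length_prefix[of "rev t" "(z @ q) @ t" "z @ q"] eq by simp
      then obtain q' where q': "z @ q = rev t @ q'" by (auto simp: prefix_def)
      have "palindrome q'" using p(1) unfolding t q' palindrome_def by simp
      from longest[OF q' this] show ?thesis
        using arg_cong[OF q', of length] by simp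
    qed simp
    then show ?thesis unfolding t by simp
  qed
  then have "is_pal_closure (z @ q) (z @ q @ rev z)"
    using q unfolding is_pal_closure_def palindrome_def by simp
  then show ?thesis by (rule is_pal_closure_unique[OF is_pal_closure_pal_closure])
qed

lemma palindrome_psi: "palindrome (psi v)"
proof (cases v rule: rev_cases)
  case Nil
  then show ?thesis by (simp add: psi_Nil palindrome_def)
next
  case (snoc u x)
  then show ?thesis
    using is_pal_closure_pal_closure[of "psi u @ [x]"] by (simp add: psi_snoc is_pal_closure_def)
qed

lemma rev_psi [simp]: "rev (psi v) = psi v"
  using palindrome_psi[of v] by (simp only: palindrome_def)

lemma prefix_psi_snoc: "prefix (psi v @ [x]) (psi (v @ [x]))"
  using is_pal_closure_pal_closure[of "psi v @ [x]"] by (simp add: psi_snoc is_pal_closure_def)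

lemma prefix_psi: "prefix u v \<Longrightarrow> prefix (psi u) (psi v)"
proof (induction v rule: rev_induct)
  case (snoc x v)
  then show ?case
    using prefix_order.trans[OF _ append_prefixD[OF prefix_psi_snoc]] by auto
qed simp

text \<open>By minimality of the closure, no palindromic prefix lies strictly between
  \<open>psi v\<close> and \<open>psi (v @ [x])\<close>: one longer than \<open>psi v\<close> has
  \<open>psi v @ [x]\<close> as a prefix, hence is at least as long as the closure.\<close>

lemma palindromic_prefix_psi:
  assumes "palindrome p" "prefix p (psi v)"
  shows "\<exists>u. prefix u v \<and> p = psi u"
  using assms
proof (induction v rule: rev_induct)
  case Nil
  then show ?case by (simp add: psi_Nil)
next
  case (snoc x v)
  consider "prefix p (psi v)" | "prefix (psi v @ [x]) p"
    using prefix_same_cases[OF snoc.prems(2) prefix_psi_snoc] by auto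
  then show ?case
  proof cases
    case 1
    with snoc obtain u where "prefix u v" "p = psi u" by blast
    then show ?thesis by auto
  next
    case 2
    have "length (psi (v @ [x])) \<le> length p"
      using is_pal_closure_pal_closure[of "psi v @ [x]"] 2 snoc.prems(1)
      by (simp add: psi_snoc is_pal_closure_def)
    then have "p = psi (v @ [x])"
      using snoc.prems(2) by (auto simp: prefix_def)
    then show ?thesis by blast
  qed
qed

text \<open>Stripping both end letters from \<open>q\<close> leaves a palindromic suffix
  \<open>s\<close> of \<open>psi v\<close> preceded by \<open>x\<close>. As \<open>psi v\<close> is
  a palindrome, \<open>s\<close> is also a prefix of it followed by \<open>x\<close>. So
  \<open>s = psi u\<close>, and the letter following \<open>psi u\<close> in \<open>psi v\<close> is
  the one following \<open>u\<close> in \<open>v\<close>.\<close>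

lemma palindromic_suffix_psi_snoc:
  assumes eq: "psi v @ [x] = z @ q" and q: "palindrome q" and len: "2 \<le> length q"
  shows "\<exists>u. prefix (u @ [x]) v \<and> q = x # psi u @ [x]"
proof -
  obtain q1 where q1: "q = q1 @ [x]"
    using eq len by (cases q rule: rev_cases) auto
  then obtain y s where ys: "q = y # s @ [x]" using len by (cases q1) auto
  have "rev q = x # rev s @ [y]" by (simp add: ys)
  then have "x # rev s @ [y] = y # s @ [x]" using q by (simp only: palindrome_def ys)
  then have yx: "x = y" and revs: "rev s = s"
    unfolding list.inject append1_eq_conv by blast+
  then have s: "palindrome s" by (simp only: palindrome_def)
  have qs: "q = x # s @ [x]" by (simp only: ys yx)
  have "psi v = z @ x # s" using eq qs by simp
  from arg_cong[OF this, of rev] have w: "psi v = (s @ [x]) @ rev z"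
    by (simp add: revs)
  then obtain u where u: "prefix u v" "s = psi u"
    using palindromic_prefix_psi[OF s, of v] by auto
  have "u \<noteq> v" using w u(2) by auto
  then obtain y t where "v = u @ y # t"
    using u(1) by (metis append_Nil2 neq_Nil_conv prefixE)
  then have y: "prefix (u @ [y]) v" by simp
  then have "prefix (psi u @ [y]) (psi v)"
    by (rule prefix_order.trans[OF prefix_psi_snoc prefix_psi])
  then have "y = x" using w u(2) by (auto simp: prefix_def)
  then show ?thesis using y qs u(2) by blast
qed

section \<open>Effect of an appended letter on \<open>psi\<close> and on letter counts\<close>

lemma psi_snoc_new:
  assumes "x \<notin> set v"
  shows "psi (v @ [x]) = psi v @ [x] @ psi v"
proof -
  have "pal_closure (psi v @ [x]) = psi v @ [x] @ rev (psi v)"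
  proof (rule pal_closure_eqI)
    fix z' q' assume h: "psi v @ [x] = z' @ q'" "palindrome q'"
    show "length q' \<le> length [x]"
    proof (rule ccontr)
      assume "\<not> length q' \<le> length [x]"
      then have "2 \<le> length q'" by simp
      from palindromic_suffix_psi_snoc[OF h this] obtain u where "prefix (u @ [x]) v" by blast
      then show False using assms by (auto simp: prefix_def)
    qed
  qed (simp add: palindrome_def)
  then show ?thesis by (simp add: psi_snoc)
qed

lemma psi_snoc_old:
  assumes "x \<notin> set v2" and v: "v = v1 @ x # v2"
  obtains r where "psi v = psi v1 @ x # r" "psi (v @ [x]) = psi v @ x # r"
proof -
  have "prefix (psi v1 @ [x]) (psi v)"
    by (rule prefix_order.trans[OF prefix_psi_snoc prefix_psi]) (simp add: v)
  then obtain r where r: "psi v = psi v1 @ x # r" by (auto simp: prefix_def)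
  let ?q = "x # psi v1 @ [x]"
  have rw: "psi v = rev r @ x # psi v1"
    using arg_cong[OF r, of rev] by simp
  have "pal_closure (rev r @ ?q) = rev r @ ?q @ rev (rev r)"
  proof (rule pal_closure_eqI)
    show "palindrome ?q" by (simp add: palindrome_def)
  next
    fix z' q' assume h: "rev r @ ?q = z' @ q'" "palindrome q'"
    show "length q' \<le> length ?q"
    proof (cases "2 \<le> length q'")
      case True
      have "psi v @ [x] = z' @ q'" using h(1) rw by simp
      from palindromic_suffix_psi_snoc[OF this h(2) True]
      obtain u where u: "prefix (u @ [x]) v" "q' = x # psi u @ [x]" by blast
      have pu: "prefix u v" using u(1) by (rule append_prefixD)
      \<comment> \<open>A longer \<open>u\<close> would place the \<open>x\<close> that follows it
        inside \<open>v2\<close>.\<close>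
      have "length u \<le> length v1"
      proof (rule ccontr)
        assume "\<not> length u \<le> length v1"
        then have "prefix (v1 @ [x]) u"
          using prefix_length_prefix[OF _ pu, of "v1 @ [x]"] v by simp
        then obtain u' where "u = v1 @ x # u'" by (auto simp: prefix_def)
        then show False using u(1) v assms(1) by (auto simp: prefix_def)
      qed
      then have "prefix u v1" using prefix_length_prefix[OF pu, of v1] v by simp
      then have "length (psi u) \<le> length (psi v1)" by (intro prefix_length_le prefix_psi)
      then show ?thesis using u(2) by simp
    qed simp
  qed
  then have "psi (v @ [x]) = psi v @ x # r" by (simp add: psi_snoc rw)
  then show thesis using r that by blast
qed

lemma count_psi_snoc_new:
  "x \<notin> set v \<Longrightarrow>
    count_list (psi (v @ [x])) z = 2 * count_list (psi v) z + (if x = z then 1 else 0)"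
  by (simp add: psi_snoc_new)

text \<open>The block appended to \<open>psi v\<close>, for \<open>v = v1 @ x # v2\<close>, is
  \<open>psi v\<close> with its prefix \<open>psi v1\<close> removed.\<close>

lemma count_psi_snoc_old:
  assumes "x \<notin> set v2"
  shows "count_list (psi (v1 @ x # v2 @ [x])) z + count_list (psi v1) z
    = 2 * count_list (psi (v1 @ x # v2)) z"
proof -
  obtain r where "psi (v1 @ x # v2) = psi v1 @ x # r"
    "psi ((v1 @ x # v2) @ [x]) = psi (v1 @ x # v2) @ x # r"
    using psi_snoc_old[OF assms refl] by blast
  then show ?thesis by simp
qed

lemma count_psi_snoc_same:
  "count_list (psi (v @ [y, y])) z + count_list (psi v) z = 2 * count_list (psi (v @ [y])) z"
  using count_psi_snoc_old[of y "[]" v z] by simp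

text \<open>Appending \<open>y\<close> does not move the last occurrence of \<open>x\<close>, so
  \<open>v @ [x]\<close> and \<open>v @ [y, x]\<close> involve the same \<open>v1\<close>, whose
  count cancels. If \<open>x\<close> is absent from \<open>v\<close>, the contribution of the new
  middle letter cancels instead.\<close>

lemma count_psi_snoc_other:
  assumes "x \<noteq> y"
  shows "count_list (psi (v @ [y, x])) z + 2 * count_list (psi v) z
    = 2 * count_list (psi (v @ [y])) z + count_list (psi (v @ [x])) z"
proof (cases "x \<in> set v")
  case True
  then obtain v1 v2 where "v = v1 @ x # v2" "x \<notin> set v2" by (metis split_list_last)
  then show ?thesis
    using count_psi_snoc_old[of x v2 v1 z] count_psi_snoc_old[of x "v2 @ [y]" v1 z] assms by simp
next
  case False
  then show ?thesis
    using count_psi_snoc_new[of x v z] count_psi_snoc_new[of x "v @ [y]" z] assms by simp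
qed

section \<open>Dynamics of the increments\<close>

lemma exchange_letter_simps [simp]:
  "exchange_letter (exchange_letter x) = x" "exchange_letter x \<noteq> x" "x \<noteq> exchange_letter x"
  by (cases x; simp)+

lemma neq_letter_iff: "x \<noteq> y \<longleftrightarrow> x = exchange_letter y"
  by (cases x; cases y) simp_all

text \<open>Here \<open>h x\<close> stands for the increment $g_x$ of the word read so far, the
  counted letter being \<open>Lb\<close>.\<close>

definition step :: "(letter \<Rightarrow> nat) \<Rightarrow> letter \<Rightarrow> letter \<Rightarrow> nat" where
  "step h x = h(exchange_letter x := h La + h Lb)"

definition total :: "(letter \<Rightarrow> nat) \<Rightarrow> nat" where
  "total h = h La + h Lb"

lemma total_eq: "total h = h x + h (exchange_letter x)"
  by (cases x) (simp_all add: total_def)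

lemma step_simps [simp]:
  "step h x x = h x" "step h x (exchange_letter x) = total h"
  by (simp_all add: step_def total_def)

abbreviation initial :: "letter \<Rightarrow> nat" where
  "initial \<equiv> (\<lambda>x. if x = Lb then 1 else 0)"

lemma count_psi_increment:
  "Suc (count_list (psi v) Lb) = total (foldl step initial v) \<and>
   (\<forall>x. count_list (psi (v @ [x])) Lb = count_list (psi v) Lb + foldl step initial v x)"
proof (induction v rule: rev_induct)
  case Nil
  have "count_list (psi [x]) Lb = initial x" for x
    using count_psi_snoc_new[of x "[]" Lb] by (simp add: psi_Nil)
  then show ?case by (simp add: psi_Nil total_def)
next
  case (snoc y v)
  let ?c = "\<lambda>u. count_list (psi u) Lb" and ?h = "foldl step initial v"
  have inc: "?c (v @ [x]) = ?c v + ?h x" for x using snoc by blast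
  have "?c (v @ [y, x]) = ?c (v @ [y]) + step ?h y x" for x
  proof (cases "x = y")
    case True
    then show ?thesis using count_psi_snoc_same[of v y Lb] inc[of y] by simp
  next
    case False
    then have "step ?h y x = ?h x + ?h y"
      using total_eq[of ?h y] by (auto simp: neq_letter_iff)
    then show ?thesis using count_psi_snoc_other[OF False, of v Lb] inc[of x] inc[of y] by simp
  qed
  moreover have "Suc (?c (v @ [y])) = total (step ?h y)"
    using snoc inc[of y] total_eq[of "step ?h y" y] by simp
  ultimately show ?case by simp
qed

section \<open>Fibonacci bound on the sum of increments, with its equality cases\<close>

lemma total_foldl_step_le:
  assumes "h (exchange_letter x) \<le> h x"
  shows "total (foldl step h w)
    \<le> fib (length w + 1) * h (exchange_letter x) + fib (length w + 2) * h x"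
  using assms
proof (induction w arbitrary: h x)
  case Nil
  then show ?case by (simp add: total_eq[of h x] numeral_2_eq_2)
next
  case (Cons y w)
  show ?case
  proof (cases "y = x")
    case True
    \<comment> \<open>Reading the letter \<open>x\<close> of larger increment replaces the smaller
      one by the sum, so the other letter now has the larger increment. The bound for
      \<open>w\<close> then equals the claimed bound by the Fibonacci recursion.\<close>
    have "total (foldl step (step h x) w)
        \<le> fib (length w + 1) * h x + fib (length w + 2) * total h"
      using Cons.IH[of "step h x" "exchange_letter x"] by (simp add: total_eq[of h x])
    then show ?thesis
      by (simp add: True total_eq[of h x] algebra_simps numeral_eq_Suc)
  next
    case False
    then have y: "y = exchange_letter x" by (simp add: neq_letter_iff)
    have "total (foldl step (step h y) w)
        \<le> fib (length w + 1) * h y + fib (length w + 2) * total h"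
      using Cons.IH[of "step h y" "exchange_letter y"] by (simp add: total_eq[of h y])
    \<comment> \<open>The bound obtained for the other letter falls short of the claimed one by
      exactly \<open>fib (length w + 1) * d\<close>.\<close>
    moreover obtain d where "h x = h (exchange_letter x) + d"
      using Cons.prems le_Suc_ex by blast
    ultimately show ?thesis
      by (simp add: y total_eq[of h x] algebra_simps numeral_eq_Suc)
  qed
qed

fun zigzag :: "letter \<Rightarrow> nat \<Rightarrow> word" where
  "zigzag x 0 = []"
| "zigzag x (Suc n) = x # zigzag (exchange_letter x) n"

text \<open>A strict gap between the increments makes the loss after a wrong letter positive.
  Positivity of the smaller increment keeps the gap strict after a right letter, since the sum then
  exceeds \<open>h x\<close>.\<close>

lemma total_foldl_step_eq_iff:
  assumes "0 < h (exchange_letter x)" "h (exchange_letter x) < h x"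
  shows "total (foldl step h w)
      = fib (length w + 1) * h (exchange_letter x) + fib (length w + 2) * h x
    \<longleftrightarrow> w = zigzag x (length w)"
  using assms
proof (induction w arbitrary: h x)
  case Nil
  then show ?case by (simp add: total_eq[of h x] numeral_2_eq_2)
next
  case (Cons y w)
  show ?case
  proof (cases "y = x")
    case True
    have "total (foldl step (step h x) w)
        = fib (length w + 1) * h x + fib (length w + 2) * total h
      \<longleftrightarrow> w = zigzag (exchange_letter x) (length w)"
      using Cons.IH[of "step h x" "exchange_letter x"] Cons.prems by (simp add: total_eq[of h x])
    then show ?thesis
      by (simp add: True total_eq[of h x] algebra_simps numeral_eq_Suc)
  next
    case False
    then have y: "y = exchange_letter x" by (simp add: neq_letter_iff)
    have "total (foldl step (step h y) w)
        \<le> fib (length w + 1) * h y + fib (length w + 2) * total h"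
      using total_foldl_step_le[of "step h y" "exchange_letter y"] by (simp add: total_eq[of h y])
    moreover obtain d where "h x = Suc (h (exchange_letter x) + d)"
      using Cons.prems less_imp_Suc_add by blast
    moreover have "0 < fib (Suc (length w))" by (simp add: fib_neq_0_nat)
    ultimately show ?thesis using False
      by (simp add: y total_eq[of h x] algebra_simps numeral_eq_Suc)
  qed
qed

text \<open>From (1,1) either first letter leads to increments 1 and 2, where the strict case forces
  alternation.\<close>

lemma total_foldl_step_balanced_eq_iff:
  assumes h: "\<And>x. h x = 1"
  shows "total (foldl step h w) = fib (length w + 3)
    \<longleftrightarrow> w = zigzag La (length w) \<or> w = zigzag Lb (length w)"
proof (cases w)
  case Nil
  then show ?thesis using h by (simp add: total_def numeral_eq_Suc)
next
  case (Cons y u)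
  have "total h = 2" using h by (simp add: total_def)
  then have "total (foldl step (step h y) u) = fib (length u + 1) + fib (length u + 2) * 2
      \<longleftrightarrow> u = zigzag (exchange_letter y) (length u)"
    using total_foldl_step_eq_iff[of "step h y" "exchange_letter y" u] h by simp
  then show ?thesis using Cons by (cases y) (simp_all add: numeral_eq_Suc add_ac)
qed

lemma step_initial_La: "step initial La = initial"
  by (simp add: step_def fun_eq_iff)

lemma count_psi_La:
  "Suc (count_list (psi (La # w)) Lb) = total (foldl step initial w)"
  using count_psi_increment[of "La # w"] by (simp add: step_initial_La)

lemma step_initial_Lb: "step initial Lb x = 1"
  by (cases x) (simp_all add: step_def)

lemma count_psi_La_le:
  "Suc (count_list (psi (La # w)) Lb) \<le> fib (length w + 2)"
  using total_foldl_step_le[of initial Lb w] by (simp add: count_psi_La)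

text \<open>The zero in \<open>initial\<close> rules out the strict criterion, so the first letter
  of \<open>w\<close> is split off: after \<open>Lb\<close> the balanced case applies.\<close>

lemma count_psi_La_eq_iff:
  "Suc (count_list (psi (La # w)) Lb) = fib (length w + 2)
    \<longleftrightarrow> w = [] \<or> (\<exists>u. w = Lb # u \<and> (u = zigzag La (length u) \<or> u = zigzag Lb (length u)))"
proof (cases w)
  case Nil
  then show ?thesis by (simp add: count_psi_La total_def numeral_2_eq_2)
next
  case (Cons y u)
  show ?thesis
  proof (cases y)
    case La
    \<comment> \<open>A second \<open>La\<close> again leaves \<open>initial\<close> unchanged, so
      only the bound for the shorter \<open>u\<close> is reached.\<close>
    have "Suc (count_list (psi (La # w)) Lb) \<le> fib (length u + 2)"
      using count_psi_La_le[of u] by (simp add: Cons La count_psi_La step_initial_La)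
    also have "\<dots> < fib (length w + 2)"
      by (simp add: Cons fib_neq_0_nat numeral_2_eq_2)
    finally show ?thesis using Cons La by simp
  next
    case Lb
    then show ?thesis
      using Cons total_foldl_step_balanced_eq_iff[where h = "step initial Lb" and w = u, OF step_initial_Lb]
      by (simp add: count_psi_La numeral_eq_Suc)
  qed
qed

section \<open>Alternating words and the two extremal words\<close>

lemma stake_cycle_zigzag: "stake n (cycle [x, exchange_letter x]) = zigzag x n"
proof (induction n arbitrary: x)
  case (Suc n)
  then show ?case using Suc[of "exchange_letter x"] cycle_Cons[of x "[exchange_letter x]"] by simp
qed simp

lemma alt_eq_zigzag: "alt n = zigzag La n"
  using stake_cycle_zigzag[of n La] by (simp add: alt_def)

lemma length_zigzag [simp]: "length (zigzag x n) = n"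
  by (induction n arbitrary: x) simp_all

lemma exchange_zigzag: "exchange (zigzag x n) = zigzag (exchange_letter x) n"
  by (induction n arbitrary: x) (simp_all add: exchange_def)

lemma exchange_Cons: "exchange (x # w) = exchange_letter x # exchange w"
  by (simp add: exchange_def)

lemma Suc_count_psi_alt: "Suc (count_list (psi (alt n)) Lb) = fib (n + 1)"
proof (cases n)
  case 0
  then show ?thesis by (simp add: alt_def psi_Nil)
next
  case (Suc m)
  then show ?thesis
    using count_psi_La_eq_iff[of "zigzag Lb m"] by (cases m) (simp_all add: alt_eq_zigzag)
qed

lemma count_psi_eq_alt_iff:
  assumes "length w = m"
  shows "count_list (psi (La # w)) Lb = count_list (psi (alt (Suc m))) Lb
    \<longleftrightarrow> La # w = alt (Suc m) \<or> La # w = exchange (swap_first (alt (Suc m)))"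
proof -
  have "count_list (psi (La # w)) Lb = count_list (psi (alt (Suc m))) Lb
      \<longleftrightarrow> Suc (count_list (psi (La # w)) Lb) = fib (length w + 2)"
    using Suc_count_psi_alt[of "Suc m"] assms by auto
  \<comment> \<open>For positive \<open>m\<close>, swapping and exchanging preserve the initial
    \<open>[La, Lb]\<close> and turn the remaining \<open>zigzag La\<close> into
    \<open>zigzag Lb\<close>. For \<open>m = 0\<close> the second word is \<open>[Lb]\<close>, which
    does not begin with \<open>La\<close>.\<close>
  also have "\<dots> \<longleftrightarrow> La # w = alt (Suc m) \<or> La # w = exchange (swap_first (alt (Suc m)))"
    unfolding count_psi_La_eq_iff using assms
    by (cases m) (auto simp: exchange_Cons exchange_zigzag alt_eq_zigzag)
  finally show ?thesis .
qed

theorem theorem4p8: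
  fixes n :: nat
  shows "int (count_list (psi (alt n)) Lb) = int (F (int n - 1)) - 1 \<and>
    (\<forall>v :: word. length v = n \<and> (\<exists>u. v = La # u) \<longrightarrow>
       count_list (psi v) Lb \<le> count_list (psi (alt n)) Lb \<and>
       (count_list (psi v) Lb = count_list (psi (alt n)) Lb \<longleftrightarrow>
          v = alt n \<or> v = exchange (swap_first (alt n))))"
proof (intro conjI allI impI)
  have "nat (int n - 1 + 2) = n + 1" by simp
  then have "F (int n - 1) = fib (n + 1)" by (simp only: F_def)
  then show "int (count_list (psi (alt n)) Lb) = int (F (int n - 1)) - 1"
    using Suc_count_psi_alt[of n] by linarith
next
  fix v :: word assume "length v = n \<and> (\<exists>u. v = La # u)"
  then obtain u where u: "v = La # u" "n = Suc (length u)" by auto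
  show "count_list (psi v) Lb \<le> count_list (psi (alt n)) Lb"
    using count_psi_La_le[of u] Suc_count_psi_alt[of n] u by simp
  show "count_list (psi v) Lb = count_list (psi (alt n)) Lb \<longleftrightarrow>
      v = alt n \<or> v = exchange (swap_first (alt n))"
    using count_psi_eq_alt_iff[OF refl, of u] u by simp
qed

end
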